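(* Let $G=(V,E)$ be a finite connected directed graph with edge costs $c\in\mathbb{R}_+^{|E|}$ and incidence matrix $D$, and let $f=\rho_1-\rho_0$ with $\rho_0,\rho_1\in\mathrm{Prob}(V)$ be such that $\{J\in\mathbb{R}^{|E|}: J\ge 0,\ D^\top J=f\}$ is nonempty. Then there exist $\tilde\alpha>0$, depending on the graph $G$ (with its edge costs) and the data $f$, and a unique solution $J_0$ of (LP) with the property that for all $\alpha\in(0,\tilde\alpha)$, $J_0$ is the unique solution of (QP) with parameter $\alpha$.
   Context: $G=(V,E)$ is a finite connected graph with directed edges $E\subseteq V\times V$ without self-loops. $\mathrm{Prob}(V)=\{\rho\in\mathbb{R}^{|V|}:\mathbb{1}^\top\rho=1,\ \rho\ge 0\}$. The incidence matrix $D\in\{-1,0,1\}^{|E|\times|V|}$ has entries $D_{ev}=-1$ if $e=(v,w)$ for some $w\in V$, $D_{ev}=1$ if $e=(w,v)$ for some $w\in V$, and $D_{ev}=0$ otherwise. Vector inequalities are entrywise and $|\cdot|$ is the Euclidean norm. (LP) is the problem of minimizing $c^\top J$ over $J\in\mathbb{R}^{|E|}$ subject to $J\ge 0$ and $D^\top J=f$; a solution of (LP) is any minimizer. (LP) may have many solutions; the uniqueness of $J_0$ in the claim refers to the stated property, not to (LP) having only one solution. For $\alpha>0$, (QP) with parameter $\alpha$ is the problem of minimizing $c^\top J+\frac{\alpha}{2}|J|^2$ over $J\in\mathbb{R}^{|E|}$ subject to $J\ge 0$ and $D^\top J=f$. *)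

theory Defs
  imports
    "HOL-Analysis.Analysis"
    "Graph_Theory.Digraph_Component"
begin

text \<open>
  A directed graph with arcs in \<open>V \<times> V\<close> is a \<^typ>\<open>'a pair_pre_digraph\<close>. The vector space indexed
  by the arcs is the set of functions that are \<open>undefined\<close> outside the arc set, so that equality of
  flows is equality of vectors. Cost, supply and probability vectors are plain functions, of which
  only the values on the arcs resp. vertices are used.
\<close>

definition prob_vectors :: "'a pair_pre_digraph \<Rightarrow> ('a \<Rightarrow> real) set" where
  "prob_vectors G = {\<rho>. (\<Sum>v\<in>pverts G. \<rho> v) = 1 \<and> (\<forall>v\<in>pverts G. 0 \<le> \<rho> v)}"

definition incidence :: "'a pair_pre_digraph \<Rightarrow> 'a \<times> 'a \<Rightarrow> 'a \<Rightarrow> real" where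
  "incidence G e v =
    (if \<exists>w\<in>pverts G. e = (v, w) then - 1
     else if \<exists>w\<in>pverts G. e = (w, v) then 1
     else 0)"

definition feasible_flows :: "'a pair_pre_digraph \<Rightarrow> ('a \<Rightarrow> real) \<Rightarrow> ('a \<times> 'a \<Rightarrow> real) set" where
  "feasible_flows G f =
    {J \<in> parcs G \<rightarrow>\<^sub>E UNIV.
      (\<forall>e\<in>parcs G. 0 \<le> J e) \<and>
      (\<forall>v\<in>pverts G. (\<Sum>e\<in>parcs G. incidence G e v * J e) = f v)}"

definition LP_cost :: "'a pair_pre_digraph \<Rightarrow> ('a \<times> 'a \<Rightarrow> real) \<Rightarrow> ('a \<times> 'a \<Rightarrow> real) \<Rightarrow> real" where
  "LP_cost G c J = (\<Sum>e\<in>parcs G. c e * J e)"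

definition QP_cost ::
    "'a pair_pre_digraph \<Rightarrow> ('a \<times> 'a \<Rightarrow> real) \<Rightarrow> real \<Rightarrow> ('a \<times> 'a \<Rightarrow> real) \<Rightarrow> real" where
  "QP_cost G c \<alpha> J = (\<Sum>e\<in>parcs G. c e * J e) + \<alpha> / 2 * (L2_set J (parcs G))\<^sup>2"

definition LP_solution ::
    "'a pair_pre_digraph \<Rightarrow> ('a \<times> 'a \<Rightarrow> real) \<Rightarrow> ('a \<Rightarrow> real) \<Rightarrow> ('a \<times> 'a \<Rightarrow> real) \<Rightarrow> bool" where
  "LP_solution G c f J \<longleftrightarrow> is_arg_min (LP_cost G c) (\<lambda>J. J \<in> feasible_flows G f) J"

definition QP_solution ::
    "'a pair_pre_digraph \<Rightarrow> ('a \<times> 'a \<Rightarrow> real) \<Rightarrow> ('a \<Rightarrow> real) \<Rightarrow> real \<Rightarrow> ('a \<times> 'a \<Rightarrow> real) \<Rightarrow> bool" where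
  "QP_solution G c f \<alpha> J \<longleftrightarrow> is_arg_min (QP_cost G c \<alpha>) (\<lambda>J. J \<in> feasible_flows G f) J"

end

theory Submission
  imports Defs
begin

text \<open>
  Let \<open>J\<^sub>0\<close> be the solution of (LP) of least Euclidean norm; it has to be the limit of the solutions of
  (QP) as \<open>\<alpha> \<rightarrow> 0\<close>, so it is the only candidate. For a feasible \<open>J\<close> and \<open>d = J - J\<^sub>0\<close>,
  the objective of (QP) at \<open>J\<close> exceeds that at \<open>J\<^sub>0\<close> by
  \<open>c \<bullet> d + \<alpha> (J\<^sub>0 \<bullet> d) + \<alpha>/2 |d|\<^sup>2\<close>, and therefore it is enough to find one constant \<open>K > 0\<close> such that \<open>J\<^sub>0 \<bullet> d + K (c \<bullet> d) \<ge> 0\<close> for all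
  feasible directions \<open>d\<close>: then \<open>J\<^sub>0\<close> is the strict minimizer for every \<open>\<alpha> < 1/K\<close>.

  For a single \<open>d\<close> such a \<open>K\<close> exists. Optimality gives \<open>c \<bullet> d \<ge> 0\<close>; if \<open>c \<bullet> d > 0\<close>, any large \<open>K\<close> works,
  and if \<open>c \<bullet> d = 0\<close>, then the whole segment from \<open>J\<^sub>0\<close> to \<open>J\<^sub>0 + d\<close> consists of solutions of (LP), so that
  \<open>J\<^sub>0 \<bullet> d \<ge> 0\<close> because \<open>J\<^sub>0\<close> has least norm. The feasible set being a polyhedron, one \<open>K\<close> serves all
  directions. This is a form of the finite generation of polyhedral cones
  (\<open>eventually_nonneg_uniform\<close>): from a direction one can subtract a multiple of a fixed direction with
  the same signs until a coordinate vanishes, without a change of sign in any other coordinate,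
  and induct on the support.

  The same reduction of supports shows that (LP) has a solution at all (\<open>LP_solution_exists\<close>), which
  is not a matter of compactness, as zero-cost arcs may make the sublevel sets unbounded. The solution
  of least norm then exists by compactness of balls.
\<close>

section \<open>From single directions to all directions\<close>

text \<open>
  The set \<open>W\<close> plays the role of the feasible directions at a point of a polyhedron, and the closure
  assumption is what a shift by a multiple of another direction needs in order to stay feasible.
  Induction on \<open>S\<close>: if no \<open>d \<in> W\<close> of this sign pattern has full support \<open>S\<close>, then the faces
  \<open>S - {e}\<close> cover everything; otherwise one \<open>d\<close> of full support and these faces generate
  everything.
\<close>
lemma eventually_nonneg_on_orthant_face:
  fixes w :: "'k \<Rightarrow> 'i \<Rightarrow> real"
  assumes "finite E" "S \<subseteq> E"
    and closed: "\<And>z d r. z \<in> W \<Longrightarrow> d \<in> W \<Longrightarrow> 0 \<le> r \<Longrightarrow> (\<forall>e\<in>E. min 0 (z e) \<le> z e - r * d e) \<Longrightarrow>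
                   (\<lambda>e. z e - r * d e) \<in> W"
    and pointwise: "\<And>d. d \<in> W \<Longrightarrow> \<forall>\<^sub>F k in F. 0 \<le> (\<Sum>e\<in>E. w k e * d e)"
  shows "\<forall>\<^sub>F k in F. \<forall>d\<in>W. (\<forall>e\<in>E. if e \<in> P then 0 \<le> d e else d e \<le> 0) \<and> (\<forall>e\<in>E-S. d e = 0)
           \<longrightarrow> 0 \<le> (\<Sum>e\<in>E. w k e * d e)"
proof -
  define C where "C S = {d \<in> W. (\<forall>e\<in>E. if e \<in> P then 0 \<le> d e else d e \<le> 0) \<and> (\<forall>e\<in>E-S. d e = 0)}" for S
  define L where "L k d = (\<Sum>e\<in>E. w k e * d e)" for k and d :: "'i \<Rightarrow> real"
  have "finite S" using assms(1,2) finite_subset by blast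
  then have "S \<subseteq> E \<Longrightarrow> \<forall>\<^sub>F k in F. \<forall>d\<in>C S. 0 \<le> L k d"
  proof (induction S rule: finite_psubset_induct)
    case (psubset S)
    have faces: "\<forall>\<^sub>F k in F. \<forall>e\<in>S. \<forall>d\<in>C (S - {e}). 0 \<le> L k d"
      using psubset by (intro eventually_ball_finite) auto
    have in_face: "\<exists>e\<in>S. d \<in> C (S - {e})" if "d \<in> C S" "e \<in> S" "d e = 0" for d e
      using that by (intro bexI[of _ e]) (auto simp: C_def)
    show ?case
    proof (cases "S \<noteq> {} \<and> (\<exists>d\<in>C S. \<forall>e\<in>S. d e \<noteq> 0)")
      case True
      then obtain d where d: "d \<in> C S" "\<And>e. e \<in> S \<Longrightarrow> d e \<noteq> 0" by blast
      have "\<forall>\<^sub>F k in F. 0 \<le> L k d"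
        using pointwise d(1) by (auto simp: L_def C_def)
      then show ?thesis using faces
      proof eventually_elim
        case (elim k)
        show ?case
        proof
          fix z assume z: "z \<in> C S"
          \<comment> \<open>the largest multiple of \<open>d\<close> that can be subtracted from \<open>z\<close> without changing a sign\<close>
          define r where "r = Min ((\<lambda>e. z e / d e) ` S)"
          have fin: "finite ((\<lambda>e. z e / d e) ` S)" "(\<lambda>e. z e / d e) ` S \<noteq> {}"
            using psubset True by auto
          obtain e0 where e0: "e0 \<in> S" "r = z e0 / d e0"
            using Min_in[OF fin] unfolding r_def by auto
          have r_le: "r \<le> z e / d e" if "e \<in> S" for e
            using that fin unfolding r_def by auto
          have sgn_z: "if e \<in> P then 0 \<le> z e else z e \<le> 0"
            and sgn_d: "if e \<in> P then 0 \<le> d e else d e \<le> 0" if "e \<in> E" for e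
            using z d(1) that by (auto simp: C_def)
          have "e0 \<in> E" using e0 psubset.prems by auto
          have r0: "0 \<le> r"
            using sgn_z[OF \<open>e0 \<in> E\<close>] sgn_d[OF \<open>e0 \<in> E\<close>]
            by (auto simp: e0(2) zero_le_divide_iff split: if_splits)
          define y where "y = (\<lambda>e. z e - r * d e)"
          have between: "if e \<in> P then 0 \<le> y e \<and> y e \<le> z e else y e \<le> 0 \<and> z e \<le> y e" if "e \<in> E" for e
          proof (cases "e \<in> S")
            case True
            show ?thesis
              using r_le[OF True] d(2)[OF True] sgn_d[OF that] r0
              by (cases "e \<in> P")
                 (auto simp: y_def pos_le_divide_eq neg_le_divide_eq less_le mult_nonneg_nonpos)
          next
            case False
            then have "z e = 0" "d e = 0" using that z d(1) by (auto simp: C_def)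
            then show ?thesis by (simp add: y_def)
          qed
          have "min 0 (z e) \<le> z e - r * d e" if "e \<in> E" for e
            using between[OF that] by (auto simp: y_def min_def split: if_splits)
          then have "y \<in> W"
            unfolding y_def using closed[of z d r] z d(1) r0 by (auto simp: C_def)
          moreover have "\<forall>e\<in>E-S. y e = 0" using z d(1) by (auto simp: y_def C_def)
          ultimately have "y \<in> C S" using between by (fastforce simp: C_def)
          moreover have "y e0 = 0" using d(2)[OF e0(1)] by (simp add: y_def e0(2))
          ultimately have "0 \<le> L k y" using in_face[of y e0] e0(1) elim(2) by blast
          moreover have "L k z = L k y + r * L k d"
            by (simp add: L_def y_def algebra_simps sum.distrib sum_subtractf sum_distrib_left)
          ultimately show "0 \<le> L k z" using r0 elim(1) by simp
        qed
      qed
    next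
      case False
      from faces show ?thesis
      proof eventually_elim
        case (elim k)
        show ?case
        proof
          fix z assume z: "z \<in> C S"
          show "0 \<le> L k z"
          proof (cases "S = {}")
            case True
            then have "L k z = 0" using z by (simp add: L_def C_def)
            then show ?thesis by simp
          next
            case nonempty: False
            then obtain e where "e \<in> S" "z e = 0" using False z by blast
            then show ?thesis using in_face[OF z] elim by blast
          qed
        qed
      qed
    qed
  qed
  then show ?thesis using assms(2) by (fastforce simp: C_def L_def elim: eventually_mono)
qed

text \<open>Finitely many sign patterns cover \<open>W\<close>.\<close>
lemma eventually_nonneg_uniform:
  fixes w :: "'k \<Rightarrow> 'i \<Rightarrow> real"
  assumes "finite E"
    and closed: "\<And>z d r. z \<in> W \<Longrightarrow> d \<in> W \<Longrightarrow> 0 \<le> r \<Longrightarrow> (\<forall>e\<in>E. min 0 (z e) \<le> z e - r * d e) \<Longrightarrow>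
                   (\<lambda>e. z e - r * d e) \<in> W"
    and pointwise: "\<And>d. d \<in> W \<Longrightarrow> \<forall>\<^sub>F k in F. 0 \<le> (\<Sum>e\<in>E. w k e * d e)"
  shows "\<forall>\<^sub>F k in F. \<forall>d\<in>W. 0 \<le> (\<Sum>e\<in>E. w k e * d e)"
proof -
  have "\<forall>\<^sub>F k in F. \<forall>P\<in>Pow E. \<forall>d\<in>W.
      (\<forall>e\<in>E. if e \<in> P then 0 \<le> d e else d e \<le> 0) \<and> (\<forall>e\<in>E-E. d e = 0) \<longrightarrow> 0 \<le> (\<Sum>e\<in>E. w k e * d e)"
    using assms by (intro eventually_ball_finite ballI eventually_nonneg_on_orthant_face) auto
  then show ?thesis
  proof eventually_elim
    case (elim k)
    show ?case
    proof
      fix d assume d: "d \<in> W"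
      show "0 \<le> (\<Sum>e\<in>E. w k e * d e)"
        using elim[rule_format, of "{e\<in>E. 0 \<le> d e}" d] d by auto
    qed
  qed
qed

section \<open>Feasible flows\<close>

text \<open>
  The base point is kept apart from the two flows that span the direction: with \<open>J1 = J3\<close> this moves
  along the line through \<open>J2\<close> and \<open>J3\<close>, with three different flows it subtracts a multiple of one
  feasible direction from another.
\<close>
lemma feasible_flows_shift:
  assumes "J1 \<in> feasible_flows G f" "J2 \<in> feasible_flows G f" "J3 \<in> feasible_flows G f"
    and nonneg: "\<And>e. e \<in> parcs G \<Longrightarrow> 0 \<le> J1 e + r * (J2 e - J3 e)"
  shows "(\<lambda>e\<in>parcs G. J1 e + r * (J2 e - J3 e)) \<in> feasible_flows G f"
proof -
  have "(\<Sum>e\<in>parcs G. incidence G e v * (J1 e + r * (J2 e - J3 e))) = f v" if "v \<in> pverts G" for v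
  proof -
    let ?s = "\<lambda>J. \<Sum>e\<in>parcs G. incidence G e v * J e"
    have "(\<Sum>e\<in>parcs G. incidence G e v * (J1 e + r * (J2 e - J3 e))) = ?s J1 + r * (?s J2 - ?s J3)"
      by (simp add: algebra_simps sum.distrib sum_subtractf sum_distrib_left)
    also have "\<dots> = f v" using assms(1-3) that by (simp add: feasible_flows_def)
    finally show ?thesis .
  qed
  then show ?thesis using nonneg by (simp add: feasible_flows_def)
qed

lemma LP_cost_shift:
  "LP_cost G c (\<lambda>e\<in>parcs G. J1 e + r * (J2 e - J3 e))
     = LP_cost G c J1 + r * (LP_cost G c J2 - LP_cost G c J3)"
  by (simp add: LP_cost_def algebra_simps sum.distrib sum_subtractf sum_distrib_left)

text \<open>
  The basic feasible solutions would do for \<open>B\<close>. If a flow \<open>J1\<close> of full support \<open>S\<close> beats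
  all candidates on smaller supports, then no \<open>z\<close> beats \<open>J1\<close>: the ray from \<open>J1\<close> through a cheaper
  \<open>z\<close> cannot go upwards in all coordinates because costs are nonnegative, so it leaves the orthant,
  and where it does so it has reached a still cheaper flow of smaller support.
\<close>
lemma finite_dominating_flows:
  assumes "finite (parcs G)" "\<forall>e\<in>parcs G. 0 \<le> c e" "S \<subseteq> parcs G"
  shows "\<exists>B. finite B \<and> B \<subseteq> feasible_flows G f \<and>
    (\<forall>J\<in>feasible_flows G f. (\<forall>e\<in>parcs G - S. J e = 0) \<longrightarrow> (\<exists>b\<in>B. LP_cost G c b \<le> LP_cost G c J))"
proof -
  define X where "X S = {J \<in> feasible_flows G f. \<forall>e\<in>parcs G - S. J e = 0}" for S
  have "finite S" using assms(1,3) finite_subset by blast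
  then have "S \<subseteq> parcs G \<Longrightarrow>
    \<exists>B. finite B \<and> B \<subseteq> feasible_flows G f \<and> (\<forall>J\<in>X S. \<exists>b\<in>B. LP_cost G c b \<le> LP_cost G c J)"
  proof (induction S rule: finite_psubset_induct)
    case (psubset S)
    have "\<forall>e\<in>S. \<exists>B. finite B \<and> B \<subseteq> feasible_flows G f \<and>
            (\<forall>J\<in>X (S - {e}). \<exists>b\<in>B. LP_cost G c b \<le> LP_cost G c J)"
    proof
      fix e assume "e \<in> S"
      then have "S - {e} \<subset> S" "S - {e} \<subseteq> parcs G" using psubset.prems by auto
      then show "\<exists>B. finite B \<and> B \<subseteq> feasible_flows G f \<and>
            (\<forall>J\<in>X (S - {e}). \<exists>b\<in>B. LP_cost G c b \<le> LP_cost G c J)"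
        by (rule psubset.IH)
    qed
    then obtain B where B: "\<And>e. e \<in> S \<Longrightarrow> finite (B e) \<and> B e \<subseteq> feasible_flows G f \<and>
            (\<forall>J\<in>X (S - {e}). \<exists>b\<in>B e. LP_cost G c b \<le> LP_cost G c J)"
      by metis
    define B' where "B' = (\<Union>e\<in>S. B e)"
    have B': "finite B'" "B' \<subseteq> feasible_flows G f"
      using B psubset by (auto simp: B'_def)
    have faces: "\<exists>b\<in>B'. LP_cost G c b \<le> LP_cost G c J" if "J \<in> X S" "e \<in> S" "J e = 0" for J e
    proof -
      have "J \<in> X (S - {e})" using that by (auto simp: X_def)
      then show ?thesis using B[OF that(2)] that(2) unfolding B'_def by blast
    qed
    show ?case
    proof (cases "\<forall>J\<in>X S. \<exists>b\<in>B'. LP_cost G c b \<le> LP_cost G c J")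
      case True
      then show ?thesis using B' by blast
    next
      case False
      then obtain J1 where J1: "J1 \<in> X S" "\<And>b. b \<in> B' \<Longrightarrow> LP_cost G c J1 < LP_cost G c b"
        by (meson not_le)
      have "LP_cost G c J1 \<le> LP_cost G c z" if z: "z \<in> X S" for z
      proof (rule ccontr)
        assume "\<not> LP_cost G c J1 \<le> LP_cost G c z"
        then have less: "LP_cost G c z < LP_cost G c J1" by simp
        define D where "D = {e \<in> S. z e < J1 e}"
        have ge: "J1 e \<le> z e" if "e \<in> parcs G" "e \<notin> D" for e
          using that z J1(1) by (cases "e \<in> S") (auto simp: D_def X_def)
        have "D \<noteq> {}"
        proof
          assume "D = {}"
          then have "J1 e \<le> z e" if "e \<in> parcs G" for e
            using that ge by simp
          then have "LP_cost G c J1 \<le> LP_cost G c z"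
            using assms(2) unfolding LP_cost_def by (intro sum_mono mult_left_mono) auto
          then show False using less by simp
        qed
        \<comment> \<open>the time at which the ray from \<open>J1\<close> through \<open>z\<close> leaves the orthant\<close>
        define t where "t = Min ((\<lambda>e. J1 e / (J1 e - z e)) ` D)"
        have fin: "finite ((\<lambda>e. J1 e / (J1 e - z e)) ` D)" "(\<lambda>e. J1 e / (J1 e - z e)) ` D \<noteq> {}"
          using psubset.hyps \<open>D \<noteq> {}\<close> by (auto simp: D_def)
        obtain e0 where e0: "e0 \<in> D" "t = J1 e0 / (J1 e0 - z e0)"
          using Min_in[OF fin] unfolding t_def by auto
        have t_le: "t \<le> J1 e / (J1 e - z e)" if "e \<in> D" for e
          using that fin unfolding t_def by auto
        have nn: "0 \<le> z e" "0 \<le> J1 e" if "e \<in> parcs G" for e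
          using z J1(1) that by (auto simp: X_def feasible_flows_def)
        have "e0 \<in> parcs G" using e0 psubset.prems by (auto simp: D_def)
        then have t0: "0 < t" using nn[of e0] e0 by (auto simp: D_def)
        let ?y = "\<lambda>e\<in>parcs G. J1 e + t * (z e - J1 e)"
        have "0 \<le> J1 e + t * (z e - J1 e)" if e: "e \<in> parcs G" for e
        proof (cases "e \<in> D")
          case True
          then show ?thesis using t_le[OF True] by (simp add: D_def pos_le_divide_eq algebra_simps)
        next
          case False
          then have "J1 e \<le> z e" using e ge by simp
          then show ?thesis using t0 nn[OF e] by simp
        qed
        then have "?y \<in> feasible_flows G f"
          using z J1(1) by (intro feasible_flows_shift) (auto simp: X_def)
        then have "?y \<in> X S" using z J1(1) by (auto simp: X_def)
        moreover have "?y e0 = 0"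
          using e0 \<open>e0 \<in> parcs G\<close> by (auto simp: D_def field_simps)
        ultimately obtain b where "b \<in> B'" "LP_cost G c b \<le> LP_cost G c ?y"
          using faces[of ?y e0] e0 by (auto simp: D_def)
        moreover have "LP_cost G c ?y < LP_cost G c J1"
          using t0 less by (simp add: LP_cost_shift mult_pos_neg)
        ultimately show False using J1(2) by force
      qed
      then show ?thesis using B' J1(1)
        by (intro exI[of _ "insert J1 B'"]) (auto simp: X_def)
    qed
  qed
  then show ?thesis using assms(3) by (auto simp: X_def)
qed

lemma LP_solution_exists:
  assumes "finite (parcs G)" "\<forall>e\<in>parcs G. 0 \<le> c e" "feasible_flows G f \<noteq> {}"
  shows "\<exists>J. LP_solution G c f J"
proof -
  have "\<exists>B. finite B \<and> B \<subseteq> feasible_flows G f \<and>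
      (\<forall>J\<in>feasible_flows G f. \<exists>b\<in>B. LP_cost G c b \<le> LP_cost G c J)"
    using finite_dominating_flows[OF assms(1,2) subset_refl] by simp
  then obtain B where B: "finite B" "B \<subseteq> feasible_flows G f"
    "\<And>J. J \<in> feasible_flows G f \<Longrightarrow> \<exists>b\<in>B. LP_cost G c b \<le> LP_cost G c J"
    by metis
  then have "B \<noteq> {}" using assms(3) by blast
  then obtain b where b: "b \<in> B" "\<And>b'. b' \<in> B \<Longrightarrow> LP_cost G c b \<le> LP_cost G c b'"
    using ex_is_arg_min_if_finite[OF B(1), of "LP_cost G c"] by (auto simp: is_arg_min_linorder)
  have "LP_cost G c b \<le> LP_cost G c J" if "J \<in> feasible_flows G f" for J
    using B(3)[OF that] b(2) by (meson order_trans)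
  then show ?thesis using b(1) B(2) by (auto simp: LP_solution_def is_arg_min_linorder)
qed

section \<open>Solutions of least norm\<close>

text \<open>
  Extensionality makes sets of bounded flows compact in the product topology: outside \<open>E\<close>
  each factor is a single point.
\<close>
lemma least_norm_in_closed_set:
  fixes X :: "('i \<Rightarrow> real) set"
  assumes "finite E" "closed X" "X \<noteq> {}" "X \<subseteq> E \<rightarrow>\<^sub>E UNIV"
  shows "\<exists>J\<in>X. \<forall>J'\<in>X. (\<Sum>e\<in>E. (J e)\<^sup>2) \<le> (\<Sum>e\<in>E. (J' e)\<^sup>2)"
proof -
  define N where "N J = (\<Sum>e\<in>E. (J e)\<^sup>2)" for J :: "'i \<Rightarrow> real"
  obtain J1 where J1: "J1 \<in> X" using assms(3) by blast
  define R where "R = sqrt (N J1)"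
  define Q where "Q = (\<Pi>\<^sub>E e\<in>UNIV. if e \<in> E then {-R..R} else {undefined :: real})"
  have "compactin (product_topology (\<lambda>_. euclidean) UNIV) Q"
    unfolding Q_def compactin_PiE by auto
  then have "compact Q" by (simp add: euclidean_product_topology)
  then have "compact (X \<inter> Q)" using assms(2) by (simp add: closed_Int_compact)
  have in_Q: "J \<in> Q" if "J \<in> X" "N J \<le> N J1" for J
  proof -
    have "\<bar>J e\<bar> \<le> R" if "e \<in> E" for e
    proof -
      have "(J e)\<^sup>2 \<le> N J" unfolding N_def using that assms(1) by (intro member_le_sum) auto
      then show ?thesis using \<open>N J \<le> N J1\<close> by (auto simp: R_def intro: real_le_rsqrt)
    qed
    then show ?thesis using that(1) assms(4) by (fastforce simp: Q_def PiE_iff extensional_def abs_le_iff)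
  qed
  have "continuous_on (X \<inter> Q) N"
    unfolding N_def by (intro continuous_intros continuous_on_subset[OF continuous_on_product_coordinates]) auto
  then obtain J where J: "J \<in> X \<inter> Q" "\<forall>J'\<in>X \<inter> Q. N J \<le> N J'"
    using continuous_attains_inf[OF \<open>compact (X \<inter> Q)\<close>] in_Q J1 by blast
  have "N J \<le> N J1" using J(2) in_Q[OF J1] J1 by simp
  then have "N J \<le> N J'" if "J' \<in> X" for J'
    using J(2) in_Q[OF that] that by (cases "N J' \<le> N J1") auto
  then show ?thesis using J(1) unfolding N_def by blast
qed

lemma closed_LP_solutions:
  assumes "finite (parcs G)"
  shows "closed {J. LP_solution G c f J}"
proof -
  have eq: "{J. LP_solution G c f J} =
    (\<Inter>e\<in>- parcs G. {J. J e = undefined}) \<inter> (\<Inter>e\<in>parcs G. {J. 0 \<le> J e}) \<inter>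
    (\<Inter>v\<in>pverts G. {J. (\<Sum>e\<in>parcs G. incidence G e v * J e) = f v}) \<inter>
    (\<Inter>J'\<in>feasible_flows G f. {J. LP_cost G c J \<le> LP_cost G c J'})"
    by (auto simp: LP_solution_def is_arg_min_linorder feasible_flows_def PiE_iff extensional_def)
  show ?thesis
    unfolding eq LP_cost_def
    by (intro closed_Int closed_INT ballI closed_Collect_eq closed_Collect_le continuous_intros
          continuous_on_subset[OF continuous_on_product_coordinates]) auto
qed

lemma least_norm_LP_solution_exists:
  assumes "finite (parcs G)" "\<forall>e\<in>parcs G. 0 \<le> c e" "feasible_flows G f \<noteq> {}"
  shows "\<exists>J. LP_solution G c f J \<and>
    (\<forall>J'. LP_solution G c f J' \<longrightarrow> (\<Sum>e\<in>parcs G. (J e)\<^sup>2) \<le> (\<Sum>e\<in>parcs G. (J' e)\<^sup>2))"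
proof -
  have "{J. LP_solution G c f J} \<subseteq> parcs G \<rightarrow>\<^sub>E UNIV"
    by (auto simp: LP_solution_def is_arg_min_def feasible_flows_def)
  then show ?thesis
    using least_norm_in_closed_set[OF assms(1) closed_LP_solutions[OF assms(1)]]
      LP_solution_exists[OF assms] by blast
qed

section \<open>The exact penalty constant\<close>

text \<open>
  By convexity the segment from \<open>J0\<close> to \<open>J\<close> consists of solutions of (LP), and along it the squared
  norm is least at \<open>J0\<close>, so its one-sided derivative there, twice this sum, cannot be negative.
\<close>
lemma least_norm_inner_nonneg:
  assumes fin: "finite (parcs G)"
    and J0: "LP_solution G c f J0"
    and least: "\<And>J'. LP_solution G c f J' \<Longrightarrow> (\<Sum>e\<in>parcs G. (J0 e)\<^sup>2) \<le> (\<Sum>e\<in>parcs G. (J' e)\<^sup>2)"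
    and J: "LP_solution G c f J"
  shows "0 \<le> (\<Sum>e\<in>parcs G. J0 e * (J e - J0 e))"
proof (rule ccontr)
  define a where "a = (\<Sum>e\<in>parcs G. J0 e * (J e - J0 e))"
  define b where "b = (\<Sum>e\<in>parcs G. (J e - J0 e)\<^sup>2)"
  assume "\<not> ?thesis"
  then have a: "a < 0" by (simp add: a_def)
  have b: "0 \<le> b" by (simp add: b_def sum_nonneg)
  have feas: "J0 \<in> feasible_flows G f" "J \<in> feasible_flows G f"
    and opt: "LP_cost G c J = LP_cost G c J0"
    using J0 J by (auto simp: LP_solution_def is_arg_min_linorder intro: antisym)
  have quad: "0 \<le> 2 * t * a + t\<^sup>2 * b" if t: "0 \<le> t" "t \<le> 1" for t
  proof -
    let ?y = "\<lambda>e\<in>parcs G. J0 e + t * (J e - J0 e)"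
    have "0 \<le> J0 e + t * (J e - J0 e)" if "e \<in> parcs G" for e
    proof -
      have "0 \<le> (1 - t) * J0 e + t * J e"
        using feas that t by (simp add: feasible_flows_def)
      then show ?thesis by (simp add: algebra_simps)
    qed
    then have "?y \<in> feasible_flows G f" by (intro feasible_flows_shift feas)
    moreover have "LP_cost G c ?y = LP_cost G c J0" by (simp add: LP_cost_shift opt)
    ultimately have "LP_solution G c f ?y"
      using J0 by (simp add: LP_solution_def is_arg_min_linorder)
    from least[OF this] have "(\<Sum>e\<in>parcs G. (J0 e)\<^sup>2) \<le> (\<Sum>e\<in>parcs G. (J0 e + t * (J e - J0 e))\<^sup>2)"
      by simp
    also have "\<dots> = (\<Sum>e\<in>parcs G. (J0 e)\<^sup>2) + 2 * t * a + t\<^sup>2 * b"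
      unfolding a_def b_def sum_distrib_left sum.distrib[symmetric]
      by (intro sum.cong refl) (simp add: power2_eq_square algebra_simps)
    finally show ?thesis by simp
  qed
  \<comment> \<open>at this \<open>t\<close> the quadratic term is still smaller than the linear one\<close>
  define t where "t = min 1 (- a / (b + 1))"
  have t: "0 < t" "t \<le> 1" "t * b < - 2 * a"
  proof -
    show "0 < t" "t \<le> 1" using a b by (auto simp: t_def intro: divide_neg_pos)
    have "t * (b + 1) \<le> - a / (b + 1) * (b + 1)"
      using b by (intro mult_right_mono) (auto simp: t_def)
    also have "\<dots> = - a" using b by simp
    finally show "t * b < - 2 * a" using \<open>0 < t\<close> a by (simp add: algebra_simps)
  qed
  have "2 * t * a + t\<^sup>2 * b = t * (2 * a + t * b)" by (simp add: power2_eq_square algebra_simps)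
  also have "\<dots> < 0" using t by (intro mult_pos_neg) auto
  finally show False using quad[of t] t by simp
qed

text \<open>
  Uniformity over all feasible directions, \<open>eventually_nonneg_uniform\<close>, applies because
  \<open>J0 + z - r d \<ge> min J0 (J0 + z) \<ge> 0\<close> when \<open>z\<close> and \<open>d\<close> are feasible directions at \<open>J0\<close> with
  \<open>min 0 z \<le> z - r d\<close>.
\<close>
lemma penalty_constant:
  assumes fin: "finite (parcs G)"
    and J0: "LP_solution G c f J0"
    and least: "\<And>J'. LP_solution G c f J' \<Longrightarrow> (\<Sum>e\<in>parcs G. (J0 e)\<^sup>2) \<le> (\<Sum>e\<in>parcs G. (J' e)\<^sup>2)"
  obtains K where "K > 0"
    "\<And>J. J \<in> feasible_flows G f \<Longrightarrow>
       0 \<le> (\<Sum>e\<in>parcs G. J0 e * (J e - J0 e)) + K * (LP_cost G c J - LP_cost G c J0)"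
proof -
  let ?E = "parcs G"
  define W where "W = (\<lambda>J e. J e - J0 e) ` feasible_flows G f"
  have feas0: "J0 \<in> feasible_flows G f" using J0 by (simp add: LP_solution_def is_arg_min_def)
  have split_sum: "(\<Sum>e\<in>?E. (J0 e + K * c e) * (J e - J0 e))
      = (\<Sum>e\<in>?E. J0 e * (J e - J0 e)) + K * (LP_cost G c J - LP_cost G c J0)" for K J
    unfolding LP_cost_def sum_subtractf[symmetric] sum_distrib_left sum.distrib[symmetric]
    by (intro sum.cong refl) (simp add: algebra_simps)
  have "\<forall>\<^sub>F K in at_top. \<forall>d\<in>W. 0 \<le> (\<Sum>e\<in>?E. (J0 e + K * c e) * d e)"
  proof (rule eventually_nonneg_uniform[OF fin])
    fix z d r assume "z \<in> W" "d \<in> W" "0 \<le> r" and le: "\<forall>e\<in>?E. min 0 (z e) \<le> z e - r * d e"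
    then obtain J1 J2 where J1: "J1 \<in> feasible_flows G f" "z = (\<lambda>e. J1 e - J0 e)"
      and J2: "J2 \<in> feasible_flows G f" "d = (\<lambda>e. J2 e - J0 e)"
      by (auto simp: W_def)
    let ?y = "\<lambda>e\<in>?E. J1 e + r * (J0 e - J2 e)"
    have "0 \<le> J1 e + r * (J0 e - J2 e)" if "e \<in> ?E" for e
    proof -
      have "0 \<le> J0 e" "0 \<le> J1 e" using J1(1) feas0 that by (auto simp: feasible_flows_def)
      then show ?thesis
        using le[rule_format, OF that] by (auto simp: J1(2) J2(2) algebra_simps min_def split: if_splits)
    qed
    then have "?y \<in> feasible_flows G f" by (intro feasible_flows_shift feas0 J1(1) J2(1))
    moreover have "(\<lambda>e. z e - r * d e) = (\<lambda>e. ?y e - J0 e)"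
    proof
      fix e
      show "z e - r * d e = ?y e - J0 e"
      proof (cases "e \<in> ?E")
        case True
        then show ?thesis by (simp add: J1(2) J2(2) algebra_simps)
      next
        case False
        then have undef: "J e = undefined" if "J \<in> feasible_flows G f" for J
          using that PiE_arb[of J ?E "\<lambda>_. UNIV" e] by (simp add: feasible_flows_def)
        show ?thesis
          using False by (simp add: J1(2) J2(2) undef[OF feas0] undef[OF J1(1)] undef[OF J2(1)])
      qed
    qed
    ultimately show "(\<lambda>e. z e - r * d e) \<in> W" unfolding W_def by blast
  next
    fix d assume "d \<in> W"
    then obtain J where J: "J \<in> feasible_flows G f" and d: "d = (\<lambda>e. J e - J0 e)"
      by (auto simp: W_def)
    have le: "LP_cost G c J0 \<le> LP_cost G c J"
      using J0 J by (simp add: LP_solution_def is_arg_min_linorder)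
    define a where "a = (\<Sum>e\<in>?E. J0 e * (J e - J0 e))"
    define g where "g = LP_cost G c J - LP_cost G c J0"
    have "\<forall>\<^sub>F K in at_top. 0 \<le> a + K * g"
    proof (cases "g = 0")
      case True
      then have "LP_solution G c f J"
        using J0 J by (auto simp: g_def LP_solution_def is_arg_min_linorder)
      then have "0 \<le> a" unfolding a_def using least_norm_inner_nonneg[OF fin J0 least] by blast
      then show ?thesis using True by simp
    next
      case False
      then have "0 < g" using le by (simp add: g_def)
      then show ?thesis
        by (intro eventually_mono[OF eventually_ge_at_top[of "- a / g"]]) (simp add: field_simps)
    qed
    then show "\<forall>\<^sub>F K in at_top. 0 \<le> (\<Sum>e\<in>?E. (J0 e + K * c e) * d e)"
      by (simp add: d split_sum a_def g_def)
  qed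
  then have "\<forall>\<^sub>F K in at_top. 0 < K \<and> (\<forall>d\<in>W. 0 \<le> (\<Sum>e\<in>?E. (J0 e + K * c e) * d e))"
    using eventually_gt_at_top[of "0::real"] by eventually_elim simp
  then obtain K :: real where K: "0 < K" "\<forall>d\<in>W. 0 \<le> (\<Sum>e\<in>?E. (J0 e + K * c e) * d e)"
    using eventually_happens'[OF trivial_limit_at_top_linorder] by blast
  show thesis
  proof (rule that[OF K(1)])
    fix J assume "J \<in> feasible_flows G f"
    then have "(\<lambda>e. J e - J0 e) \<in> W" by (simp add: W_def)
    with K(2) show "0 \<le> (\<Sum>e\<in>?E. J0 e * (J e - J0 e)) + K * (LP_cost G c J - LP_cost G c J0)"
      using split_sum[of K J] by fastforce
  qed
qed

lemma QP_cost_expansion: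
  "QP_cost G c \<alpha> J - QP_cost G c \<alpha> J0 = (LP_cost G c J - LP_cost G c J0)
     + \<alpha> * (\<Sum>e\<in>parcs G. J0 e * (J e - J0 e)) + \<alpha> / 2 * (\<Sum>e\<in>parcs G. (J e - J0 e)\<^sup>2)"
proof -
  have L2: "(L2_set J (parcs G))\<^sup>2 = (\<Sum>e\<in>parcs G. (J e)\<^sup>2)" for J
    by (simp add: L2_set_def sum_nonneg)
  have "(\<Sum>e\<in>parcs G. (J e)\<^sup>2) = (\<Sum>e\<in>parcs G. (J0 e)\<^sup>2) + 2 * (\<Sum>e\<in>parcs G. J0 e * (J e - J0 e))
      + (\<Sum>e\<in>parcs G. (J e - J0 e)\<^sup>2)"
    unfolding sum_distrib_left sum.distrib[symmetric]
    by (intro sum.cong refl) (simp add: power2_eq_square algebra_simps)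
  then show ?thesis unfolding QP_cost_def LP_cost_def L2 by (simp add: algebra_simps)
qed

section \<open>Exact regularization\<close>

theorem mainTheorem2:
  fixes G :: "'a pair_pre_digraph"
    and c :: "'a \<times> 'a \<Rightarrow> real"
    and f \<rho>\<^sub>0 \<rho>\<^sub>1 :: "'a \<Rightarrow> real"
  assumes "pair_digraph G"
    and "Digraph_Component.connected (with_proj G)"
    and "\<forall>e\<in>parcs G. 0 \<le> c e"
    and "\<rho>\<^sub>0 \<in> prob_vectors G" and "\<rho>\<^sub>1 \<in> prob_vectors G"
    and "\<forall>v\<in>pverts G. f v = \<rho>\<^sub>1 v - \<rho>\<^sub>0 v"
    and "feasible_flows G f \<noteq> {}"
  shows "\<exists>\<alpha>'>0. \<exists>!J\<^sub>0. LP_solution G c f J\<^sub>0 \<and>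
    (\<forall>\<alpha>\<in>{0<..<\<alpha>'}. QP_solution G c f \<alpha> J\<^sub>0 \<and> (\<forall>J. QP_solution G c f \<alpha> J \<longrightarrow> J = J\<^sub>0))"
proof -
  interpret pair_digraph G by fact
  have fin: "finite (parcs G)" by (rule pair_finite_arcs)
  obtain J0 where J0: "LP_solution G c f J0"
    and least: "\<And>J'. LP_solution G c f J' \<Longrightarrow> (\<Sum>e\<in>parcs G. (J0 e)\<^sup>2) \<le> (\<Sum>e\<in>parcs G. (J' e)\<^sup>2)"
    using least_norm_LP_solution_exists[OF fin assms(3,7)] by blast
  obtain K where K: "0 < K" "\<And>J. J \<in> feasible_flows G f \<Longrightarrow>
       0 \<le> (\<Sum>e\<in>parcs G. J0 e * (J e - J0 e)) + K * (LP_cost G c J - LP_cost G c J0)"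
    using penalty_constant[OF fin J0 least] by blast
  have feas0: "J0 \<in> feasible_flows G f" using J0 by (simp add: LP_solution_def is_arg_min_def)
  have strict: "QP_cost G c \<alpha> J0 < QP_cost G c \<alpha> J"
    if J: "J \<in> feasible_flows G f" "J \<noteq> J0" and \<alpha>: "0 < \<alpha>" "\<alpha> < 1 / K" for J \<alpha>
  proof -
    define a where "a = (\<Sum>e\<in>parcs G. J0 e * (J e - J0 e))"
    define g where "g = LP_cost G c J - LP_cost G c J0"
    have "0 \<le> g" using J0 J(1) by (simp add: g_def LP_solution_def is_arg_min_linorder)
    moreover have "\<alpha> * K \<le> 1" using \<alpha> K(1) by (simp add: field_simps)
    ultimately have "0 \<le> (1 - \<alpha> * K) * g" by simp
    moreover have "0 \<le> \<alpha> * (a + K * g)" using K(2)[OF J(1)] \<alpha>(1) by (simp add: a_def g_def)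
    ultimately have nonneg: "0 \<le> g + \<alpha> * a" by (simp add: algebra_simps)
    obtain e where "e \<in> parcs G" "J e \<noteq> J0 e"
      using J feas0 PiE_ext[of J "parcs G" "\<lambda>_. UNIV" J0] unfolding feasible_flows_def by blast
    then have "0 < (\<Sum>e\<in>parcs G. (J e - J0 e)\<^sup>2)"
      using fin by (intro sum_pos2[of _ e]) auto
    then have "0 < \<alpha> / 2 * (\<Sum>e\<in>parcs G. (J e - J0 e)\<^sup>2)" using \<alpha>(1) by simp
    then have "0 < QP_cost G c \<alpha> J - QP_cost G c \<alpha> J0"
      using nonneg by (simp add: QP_cost_expansion a_def g_def)
    then show ?thesis by simp
  qed
  have sol: "QP_solution G c f \<alpha> J \<longleftrightarrow> J = J0" if "\<alpha> \<in> {0<..<1 / K}" for \<alpha> J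
    using strict[of _ \<alpha>] that feas0 unfolding QP_solution_def is_arg_min_def
    by (metis greaterThanLessThan_iff less_asym less_irrefl)
  show ?thesis
  proof (intro exI[of _ "1 / K"] conjI ex1I[of _ J0])
    show "0 < 1 / K" using K(1) by simp
    show "LP_solution G c f J0" by (rule J0)
    show "\<forall>\<alpha>\<in>{0<..<1 / K}. QP_solution G c f \<alpha> J0 \<and> (\<forall>J. QP_solution G c f \<alpha> J \<longrightarrow> J = J0)"
      using sol by blast
  next
    fix J assume "LP_solution G c f J \<and> (\<forall>\<alpha>\<in>{0<..<1 / K}. QP_solution G c f \<alpha> J \<and>
      (\<forall>J'. QP_solution G c f \<alpha> J' \<longrightarrow> J' = J))"
    moreover have "1 / (2 * K) \<in> {0<..<1 / K}" using K(1) by (simp add: field_simps)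
    ultimately show "J = J0" using sol by blast
  qed
qed

end
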